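(* Assume $m_k<n_k+1$ for all $k\in\{1,\dots,M\}$. Furthermore, assume that one of the following conditions is fulfilled: \begin{enumerate} \item $m_i<1$ for some $i$. \item $m_k\ge 1$ for all $k$, $m_i=1$ for some $i$, and $\sum_{k:\,m_k=1}\lambda_k r_k(t)>b(t)$ for all $t$. \item $m_k>1$ for all $k$, and there is a constant $\gamma_1\in\mathbb{R}$ such that $\sum_{k=1}^{M}\lambda_k r_k(t)\frac{e^{(m_k-1)\gamma_1}}{1+e^{n_k(\gamma_1+C)}}>b(t)$ for all $t$. \end{enumerate} Then the equation $$x'(t)=\sum_{k=1}^{M}\lambda_k r_k(t)\frac{x^{m_k}(t-\tau_k(t))}{1+x^{n_k}(t-\mu_k(t))}-b(t)x(t)$$ admits at least one positive $T$-periodic solution.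
   Context: Let $T>0$ and let $M\ge 1$ be an integer. For $k=1,\dots,M$, let $\lambda_k,m_k,n_k$ be positive real constants, and let $r_k,\tau_k,\mu_k$ and $b$ be continuous, positive, $T$-periodic functions $\mathbb{R}\to\mathbb{R}$. Set $C:=\int_0^T b(t)\,dt$. Here $x^{m}(s)$ means $(x(s))^{m}$. A positive $T$-periodic solution is a $T$-periodic differentiable function $x:\mathbb{R}\to(0,\infty)$ satisfying the equation for all $t\in\mathbb{R}$. *)

theory Defs
  imports "HOL-Analysis.Analysis" "HOL-Library.Periodic_Fun"
begin

text \<open>
  Real powers of positive quantities are \<open>powr\<close>. Periodicity with period \<open>T\<close> is the library
  predicate \<open>periodic_fun_simple f T\<close>, i.e. \<open>f (x + T) = f x\<close> for all \<open>x\<close>; \<open>T\<close> need not be the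
  least period.
\<close>

definition coefficient_function :: "real \<Rightarrow> (real \<Rightarrow> real) \<Rightarrow> bool" where
  "coefficient_function T f \<longleftrightarrow>
     continuous_on UNIV f \<and> (\<forall>t. f t > 0) \<and> periodic_fun_simple f T"

definition positive_periodic_solution ::
  "real \<Rightarrow> nat \<Rightarrow> (nat \<Rightarrow> real) \<Rightarrow> (nat \<Rightarrow> real) \<Rightarrow> (nat \<Rightarrow> real) \<Rightarrow>
   (nat \<Rightarrow> real \<Rightarrow> real) \<Rightarrow> (nat \<Rightarrow> real \<Rightarrow> real) \<Rightarrow> (nat \<Rightarrow> real \<Rightarrow> real) \<Rightarrow>
   (real \<Rightarrow> real) \<Rightarrow> (real \<Rightarrow> real) \<Rightarrow> bool" where
  "positive_periodic_solution T M lam m n r \<tau> \<mu> b x \<longleftrightarrow>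
     (\<forall>t. x t > 0) \<and> periodic_fun_simple x T \<and>
     (\<forall>t. (x has_real_derivative
            (\<Sum>k=1..M. lam k * r k t *
               (x (t - \<tau> k t) powr m k / (1 + x (t - \<mu> k t) powr n k))) - b t * x t) (at t))"

end

theory Submission
  imports Defs "HOL-Complex_Analysis.Great_Picard" "HOL-Real_Asymp.Real_Asymp"
begin

text \<open>
  For a \<open>T\<close>-periodic forcing term \<open>h\<close> the equation \<open>z' = h - b z\<close> has a \<open>T\<close>-periodic solution,
  which depends monotonically on \<open>h\<close> and is the constant \<open>c\<close> for \<open>h = c b\<close>; if \<open>h \<ge> 0\<close> then
  \<open>z t \<ge> e\<^sup>-\<^sup>C z s\<close> for all \<open>s\<close> and \<open>t\<close>. Sending \<open>x\<close> to the solution whose forcing term is the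
  production term evaluated at \<open>x\<close> turns the problem into a fixed point problem. The production term
  is first truncated: both delayed values are cut off below at a level \<open>p\<close>, and the value in the
  denominator is also cut off below at \<open>e\<^sup>-\<^sup>C\<close> times the value in the numerator. Since
  \<open>m\<^sub>k < n\<^sub>k + 1\<close>, the truncated term is then sublinear, so the map preserves \<open>0 \<le> x \<le> R\<close> for
  large \<open>R\<close>. Each of the three conditions yields a \<open>p\<close> with
  \<open>\<Sum> \<lambda>\<^sub>k r\<^sub>k p\<^bsup>m\<^sub>k\<^esup> / (1 + (p e\<^sup>C)\<^bsup>n\<^sub>k\<^esup>) \<ge> p b\<close>; a fixed point that falls below \<open>p\<close> somewhere stays
  below \<open>p e\<^sup>C\<close>, so its forcing term is at least \<open>p b\<close> and the fixed point is at least \<open>p\<close> after all.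
  At a fixed point the truncations are therefore inactive.

  Schauder's theorem on the order interval \<open>0 \<le> x \<le> R\<close> reduces to Kuhn's combinatorial lemma on
  cubes of arbitrary dimension, through a periodic partition of unity and the Arzela-Ascoli theorem.
\<close>

subsection \<open>A fixed point theorem for periodic functions\<close>

text \<open>Kuhn's lemma applies once each grid point is labelled, coordinate by coordinate, by the
  direction in which \<open>f\<close> moves it. Points of the cube are functions on
  \<open>nat\<close> of which only the first \<open>N\<close> values count, so the dimension is a
  variable and not a type.\<close>

lemma approximate_fixed_point_cube:
  fixes f :: "(nat \<Rightarrow> real) \<Rightarrow> nat \<Rightarrow> real" and N :: nat and R \<epsilon> :: real
  assumes "R > 0" and "\<epsilon> > 0"
    and maps: "\<And>u. (\<forall>i<N. u i \<in> {0..R}) \<Longrightarrow> \<forall>i<N. f u i \<in> {0..R}"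
    and ucont: "\<And>e. e > 0 \<Longrightarrow> \<exists>d>0. \<forall>u v. (\<forall>i<N. u i \<in> {0..R} \<and> v i \<in> {0..R} \<and> \<bar>u i - v i\<bar> \<le> d)
                  \<longrightarrow> (\<forall>i<N. \<bar>f u i - f v i\<bar> \<le> e)"
  shows "\<exists>u. (\<forall>i<N. u i \<in> {0..R}) \<and> (\<forall>i<N. \<bar>f u i - u i\<bar> \<le> \<epsilon>)"
proof -
  obtain d where "d > 0" and d: "\<And>u v i. \<lbrakk>\<And>i. i < N \<Longrightarrow> u i \<in> {0..R} \<and> v i \<in> {0..R} \<and> \<bar>u i - v i\<bar> \<le> d; i < N\<rbrakk>
                  \<Longrightarrow> \<bar>f u i - f v i\<bar> \<le> \<epsilon>/2"
    using ucont[of "\<epsilon>/2"] \<open>\<epsilon> > 0\<close> by (auto simp del: atLeastAtMost_iff)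
  \<comment> \<open>The grid has \<open>p\<close> steps per edge, enough to make the mesh
    \<open>R / p\<close> at most \<open>d\<close> and at most half of \<epsilon>.\<close>
  obtain p :: nat where p: "real p > R / min d (\<epsilon>/2)"
    using reals_Archimedean2 by blast
  have "min d (\<epsilon>/2) > 0" using \<open>d > 0\<close> \<open>\<epsilon> > 0\<close> by simp
  then have "real p > 0" using p \<open>R > 0\<close> by (smt (verit) divide_pos_pos)
  then have "p > 0" by simp
  have "R / real p \<le> min d (\<epsilon>/2)"
    using p \<open>min d (\<epsilon>/2) > 0\<close> \<open>real p > 0\<close>
    by (metis less_imp_le mult.commute pos_divide_le_eq pos_divide_less_eq)
  then have mesh: "R / real p \<le> d" "R / real p \<le> \<epsilon>/2" by simp_all
  define g where "g x = (\<lambda>i. R * real (x i) / real p)" for x :: "nat \<Rightarrow> nat"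
  \<comment> \<open>The values on opposite faces are those that \<open>kuhn_lemma\<close>
    prescribes. They fit the directions there because \<open>f\<close> stays between 0 and
    \<open>R\<close>: label 0 always means that \<open>f\<close> does not decrease the coordinate,
    label 1 that it does not increase it.\<close>
  define label where
    "label x i = (if x i = 0 then 0 else if x i = p then 1 else if f (g x) i \<ge> g x i then 0 else 1 :: nat)"
    for x i
  obtain q where q: "\<forall>i<N. q i < p" and
    rs: "\<forall>i<N. \<exists>r s. (\<forall>j<N. q j \<le> r j \<and> r j \<le> q j + 1) \<and> (\<forall>j<N. q j \<le> s j \<and> s j \<le> q j + 1) \<and> label r i \<noteq> label s i"
    by (rule kuhn_lemma[of p N label]) (use \<open>p > 0\<close> in \<open>auto simp: label_def\<close>)
  have g_range: "\<forall>i<N. g x i \<in> {0..R}" if "\<forall>i<N. x i \<le> p" for x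
    using that \<open>R > 0\<close> \<open>p > 0\<close> by (auto simp: g_def field_simps)
  have q_le: "\<forall>i<N. q i \<le> p" using q by (simp add: less_imp_le)
  have g_near: "g q j \<le> g x j \<and> g x j \<le> g q j + R / real p" if "q j \<le> x j" "x j \<le> q j + 1" for x j
  proof -
    have "real (q j) \<le> real (x j)" "real (x j) \<le> real (q j) + 1" using that by linarith+
    then have "R * real (q j) \<le> R * real (x j)" "R * real (x j) \<le> R * (real (q j) + 1)"
      using \<open>R > 0\<close> by simp_all
    then show ?thesis using \<open>p > 0\<close> by (simp add: g_def field_simps)
  qed
  \<comment> \<open>A label at a corner \<open>x\<close> of the cell gives a one-sided estimate at
    the base corner \<open>q\<close>: moving from \<open>x\<close> to \<open>q\<close> costs at most
    half of \<epsilon> in the value of \<open>f\<close> and half in the point itself. Every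
    coordinate sees both labels, hence both estimates.\<close>
  have near: "(label x i = 0 \<longrightarrow> g q i - \<epsilon> \<le> f (g q) i) \<and> (label x i = 1 \<longrightarrow> f (g q) i \<le> g q i + \<epsilon>)"
    if x: "\<forall>j<N. q j \<le> x j \<and> x j \<le> q j + 1" and "i < N" for x i
  proof -
    have x_le: "\<forall>i<N. x i \<le> p" using x q by (metis Suc_eq_plus1 Suc_leI le_trans)
    have near_x: "g q j \<le> g x j \<and> g x j \<le> g q j + R / real p" if "j < N" for j
      using g_near x that by blast
    have "\<bar>f (g x) i - f (g q) i\<bar> \<le> \<epsilon>/2"
    proof (rule d)
      fix j assume "j < N"
      then have "\<bar>g x j - g q j\<bar> \<le> d" using near_x[of j] mesh(1) by linarith
      then show "g x j \<in> {0..R} \<and> g q j \<in> {0..R} \<and> \<bar>g x j - g q j\<bar> \<le> d"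
        using g_range[OF x_le] g_range[OF q_le] \<open>j < N\<close> by blast
    qed fact
    moreover have "0 \<le> f (g x) i \<and> f (g x) i \<le> R" using maps[OF g_range[OF x_le]] \<open>i < N\<close> by simp
    moreover have "x i = 0 \<Longrightarrow> g x i = 0" "x i = p \<Longrightarrow> g x i = R" using \<open>p > 0\<close> by (auto simp: g_def)
    ultimately have "label x i = 0 \<Longrightarrow> g x i \<le> f (g x) i" "label x i = 1 \<Longrightarrow> f (g x) i \<le> g x i"
      by (auto simp: label_def split: if_splits)
    then show ?thesis
      using near_x[OF \<open>i < N\<close>] mesh(2) \<open>\<bar>f (g x) i - f (g q) i\<bar> \<le> \<epsilon>/2\<close>
      by (smt (verit) field_sum_of_halves)
  qed
  have "\<bar>f (g q) i - g q i\<bar> \<le> \<epsilon>" if "i < N" for i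
  proof -
    obtain r s where r: "\<forall>j<N. q j \<le> r j \<and> r j \<le> q j + 1" and s: "\<forall>j<N. q j \<le> s j \<and> s j \<le> q j + 1"
      and "label r i \<noteq> label s i"
      using rs \<open>i < N\<close> by blast
    moreover have "label x i = 0 \<or> label x i = 1" for x by (simp add: label_def)
    ultimately have "label r i = 0 \<and> label s i = 1 \<or> label r i = 1 \<and> label s i = 0" by metis
    then show ?thesis using near[OF r that] near[OF s that] by linarith
  qed
  then show ?thesis using g_range[OF q_le] by blast
qed

section \<open>Periodic functions and partitions of unity\<close>

lemma periodic_translate:
  fixes f :: "real \<Rightarrow> 'a"
  assumes "periodic_fun_simple f T"
  shows "f (t + of_int j * T) = f t"
proof -
  interpret periodic_fun_simple f T by fact
  show ?thesis by (rule plus_of_int)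
qed

lemma translate_into_period:
  fixes s t T :: real
  assumes "T > 0"
  obtains j :: int where "s \<le> t + of_int j * T" and "t + of_int j * T \<le> s + T"
proof
  have "of_int \<lceil>(s - t) / T\<rceil> < (s - t) / T + 1" "(s - t) / T \<le> of_int \<lceil>(s - t) / T\<rceil>"
    by linarith+
  then have "of_int \<lceil>(s - t) / T\<rceil> * T < ((s - t) / T + 1) * T" "(s - t) / T * T \<le> of_int \<lceil>(s - t) / T\<rceil> * T"
    using assms by (simp_all only: mult_less_cancel_right_pos mult_le_cancel_right_pos)
  then show "s \<le> t + of_int \<lceil>(s - t) / T\<rceil> * T" "t + of_int \<lceil>(s - t) / T\<rceil> * T \<le> s + T"
    using assms by (simp_all add: distrib_right)
qed

lemma periodic_attains_bounds:
  fixes f :: "real \<Rightarrow> real"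
  assumes "T > 0" and "continuous_on UNIV f" and "periodic_fun_simple f T"
  obtains u v where "\<And>t. f u \<le> f t" and "\<And>t. f t \<le> f v"
proof -
  have "compact {0..T}" "{0..T} \<noteq> {}" "continuous_on {0..T} f"
    using assms by (auto intro: continuous_on_subset)
  then obtain u v where u: "\<forall>t\<in>{0..T}. f u \<le> f t" and v: "\<forall>t\<in>{0..T}. f t \<le> f v"
    using continuous_attains_inf[of "{0..T}" f] continuous_attains_sup[of "{0..T}" f] by blast
  have "f u \<le> f t \<and> f t \<le> f v" for t
  proof -
    obtain j :: int where "0 \<le> t + of_int j * T" "t + of_int j * T \<le> 0 + T"
      using translate_into_period[OF \<open>T > 0\<close>] by metis
    then show ?thesis using u v periodic_translate[OF assms(3), of t j]
      by (metis add_0 atLeastAtMost_iff)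
  qed
  then show ?thesis using that by blast
qed

text \<open>Tent functions of radius \<eta> about \<open>N\<close> equally spaced nodes of one
  period, divided by their sum. The tents measure the distance to the lattice of multiples of
  \<open>T\<close>, which makes them periodic; their sum is positive because the spacing is below
  \<eta>.\<close>

lemma periodic_partition_of_unity:
  fixes T \<eta> :: real
  assumes "T > 0" and "\<eta> > 0"
  shows "\<exists>(N::nat) (s::nat \<Rightarrow> real) (\<phi>::nat \<Rightarrow> real \<Rightarrow> real).
      (\<forall>j. continuous_on UNIV (\<phi> j) \<and> periodic_fun_simple (\<phi> j) T \<and> (\<forall>t. \<phi> j t \<ge> 0))
      \<and> (\<forall>t. (\<Sum>j<N. \<phi> j t) = 1)
      \<and> (\<forall>j t. \<phi> j t > 0 \<longrightarrow> (\<exists>i::int. \<bar>t + of_int i * T - s j\<bar> < \<eta>))"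
proof -
  obtain N :: nat where N: "real N > T / \<eta>"
    using reals_Archimedean2 by blast
  then have "real N > 0" using assms by (smt (verit) divide_pos_pos)
  then have "N > 0" by simp
  have mesh: "T / real N < \<eta>" using N \<open>real N > 0\<close> assms by (simp add: field_simps)
  define P where "P = range (\<lambda>i::int. of_int i * T)"
  define s where "s j = real j * T / real N" for j
  define w where "w j t = max 0 (\<eta> - infdist (t - s j) P)" for j t
  have P_shift: "infdist (x + T) P = infdist x P" for x
  proof -
    have "P = (+) T ` P"
    proof
      show "P \<subseteq> (+) T ` P"
      proof
        fix y assume "y \<in> P"
        then obtain i :: int where "y = of_int i * T" by (auto simp: P_def)
        then have "y = T + of_int (i - 1) * T" by (simp add: algebra_simps)
        then show "y \<in> (+) T ` P" unfolding P_def by blast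
      qed
      show "(+) T ` P \<subseteq> P"
      proof
        fix y assume "y \<in> (+) T ` P"
        then obtain i :: int where "y = T + of_int i * T" by (auto simp: P_def)
        then have "y = of_int (i + 1) * T" by (simp add: algebra_simps)
        then show "y \<in> P" unfolding P_def by blast
      qed
    qed
    then have "infdist (x + T) P = infdist (x + T) ((+) T ` P)" by simp
    also have "\<dots> = infdist x P"
      by (simp add: infdist_def image_image dist_real_def add.commute)
    finally show ?thesis .
  qed
  have w_cont: "continuous_on UNIV (w j)" for j
    unfolding w_def by (intro continuous_intros)
  have w_shift: "w j (t + T) = w j t" for j t
    using P_shift[of "t - s j"] by (simp add: w_def algebra_simps)
  have w_nonneg: "w j t \<ge> 0" for j t by (simp add: w_def)
  have w_support: "\<exists>i::int. \<bar>t + of_int i * T - s j\<bar> < \<eta>" if "w j t > 0" for j t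
  proof -
    have "infdist (t - s j) P < \<eta>" using that by (simp add: w_def split: if_splits)
    moreover have "P \<noteq> {}" by (simp add: P_def)
    ultimately obtain y where "y \<in> P" "dist (t - s j) y < \<eta>"
      by (force simp: infdist_notempty cINF_less_iff)
    then obtain i :: int where "\<bar>t - s j - of_int i * T\<bar> < \<eta>" by (auto simp: P_def dist_real_def)
    then have "\<bar>t + of_int (-i) * T - s j\<bar> < \<eta>" by (simp add: algebra_simps)
    then show ?thesis by blast
  qed
  have w_sum: "(\<Sum>j<N. w j t) > 0" for t
  proof -
    \<comment> \<open>\<open>k\<close> numbers the last node at or to the left of \<open>t\<close>
      on the whole line. Its residue modulo \<open>N\<close> is the node within the period, its
      quotient the lattice translate.\<close>
    define k where "k = \<lfloor>t * real N / T\<rfloor>"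
    define j where "j = nat (k mod int N)"
    have "j < N" using \<open>N > 0\<close> by (simp add: j_def nat_less_iff)
    have k: "k = int j + (k div int N) * int N" using \<open>N > 0\<close> by (simp add: j_def)
    have k': "real_of_int k = real j + of_int (k div int N) * real N"
      by (subst k) simp
    have "of_int k \<le> t * real N / T" "t * real N / T < of_int k + 1" by (simp_all add: k_def)
    then have "of_int k * T / real N \<le> t" "t < of_int k * T / real N + T / real N"
      using \<open>T > 0\<close> \<open>N > 0\<close> by (simp_all add: field_simps)
    moreover have "of_int k * T / real N = s j + of_int (k div int N) * T"
      using \<open>N > 0\<close> by (simp add: k' s_def field_simps)
    ultimately have "dist (t - s j) (of_int (k div int N) * T) < \<eta>"
      using mesh by (simp add: dist_real_def)
    moreover have "infdist (t - s j) P \<le> dist (t - s j) (of_int (k div int N) * T)"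
      unfolding P_def by (intro infdist_le rangeI)
    ultimately have "w j t > 0" by (simp add: w_def)
    then show ?thesis using \<open>j < N\<close> w_nonneg by (intro sum_pos2[of _ j]) auto
  qed
  show ?thesis
  proof (intro exI[of _ N] exI[of _ s] exI[of _ "\<lambda>j t. w j t / (\<Sum>i<N. w i t)"] conjI allI impI)
    fix j t
    show "continuous_on UNIV (\<lambda>t. w j t / (\<Sum>i<N. w i t))"
      using w_sum by (intro continuous_intros w_cont) (metis less_irrefl)
    show "periodic_fun_simple (\<lambda>t. w j t / (\<Sum>i<N. w i t)) T"
      by unfold_locales (simp add: w_shift)
    show "w j t / (\<Sum>i<N. w i t) \<ge> 0"
      using w_nonneg w_sum by (simp add: less_imp_le)
    show "(\<Sum>j<N. w j t / (\<Sum>i<N. w i t)) = 1"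
      using w_sum[of t] by (simp flip: sum_divide_distrib)
    show "\<exists>i::int. \<bar>t + of_int i * T - s j\<bar> < \<eta>" if "w j t / (\<Sum>i<N. w i t) > 0"
      using that w_sum[of t] w_support by (simp add: zero_less_divide_iff)
  qed
qed

section \<open>Schauder's theorem on the order interval\<close>

definition periodic_box :: "real \<Rightarrow> real \<Rightarrow> (real \<Rightarrow> real) set" where
  "periodic_box T R = {x. continuous_on UNIV x \<and> periodic_fun_simple x T \<and> (\<forall>t. x t \<in> {0..R})}"

context
  fixes T R L :: real and \<Phi> :: "(real \<Rightarrow> real) \<Rightarrow> real \<Rightarrow> real"
  assumes "T > 0" and "R > 0"
    and maps: "\<And>x. x \<in> periodic_box T R \<Longrightarrow> \<Phi> x \<in> periodic_box T R"
    and ucont: "\<And>e. e > 0 \<Longrightarrow> \<exists>d>0. \<forall>x\<in>periodic_box T R. \<forall>y\<in>periodic_box T R.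
                  (\<forall>t. \<bar>x t - y t\<bar> \<le> d) \<longrightarrow> (\<forall>t. \<bar>\<Phi> x t - \<Phi> y t\<bar> \<le> e)"
    and lipschitz: "\<And>x s t. x \<in> periodic_box T R \<Longrightarrow> \<bar>\<Phi> x s - \<Phi> x t\<bar> \<le> L * \<bar>s - t\<bar>"
begin

text \<open>Discretization: a vector \<open>u\<close> in the cube becomes the average
  \<open>P u\<close>, and \<open>\<Phi> (P u)\<close> is sampled at the nodes \<open>s j\<close>. If
  the samples nearly return \<open>u\<close>, then \<open>P u\<close> is nearly fixed, since the
  Lipschitz bound controls \<open>\<Phi> (P u)\<close> between a point and the nodes near
  it.\<close>

lemma periodic_box_approximate_fixed_point:
  assumes "\<epsilon> > 0"
  shows "\<exists>x\<in>periodic_box T R. \<forall>t. \<bar>\<Phi> x t - x t\<bar> \<le> \<epsilon>"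
proof -
  \<comment> \<open>The radius at which the Lipschitz bound costs at most half of \<epsilon>; adding
    1 covers \<open>L = 0\<close>.\<close>
  define \<eta> where "\<eta> = \<epsilon> / (2 * (\<bar>L\<bar> + 1))"
  have "\<eta> > 0" using assms by (simp add: \<eta>_def)
  have L\<eta>: "\<bar>L\<bar> * \<eta> \<le> \<epsilon> / 2" using assms by (simp add: \<eta>_def field_simps)
  obtain N :: nat and s and \<phi> :: "nat \<Rightarrow> real \<Rightarrow> real" where "\<forall>j. continuous_on UNIV (\<phi> j) \<and> periodic_fun_simple (\<phi> j) T \<and> (\<forall>t. \<phi> j t \<ge> 0)"
    and "\<forall>t. (\<Sum>j<N. \<phi> j t) = 1"
    and "\<forall>j t. \<phi> j t > 0 \<longrightarrow> (\<exists>i::int. \<bar>t + of_int i * T - s j\<bar> < \<eta>)"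
    using periodic_partition_of_unity[OF \<open>T > 0\<close> \<open>\<eta> > 0\<close>] by blast
  then have \<phi>: "\<And>j. continuous_on UNIV (\<phi> j)" "\<And>j. periodic_fun_simple (\<phi> j) T"
      "\<And>j t. \<phi> j t \<ge> 0" "\<And>t. (\<Sum>j<N. \<phi> j t) = 1"
    and support: "\<And>j t. \<phi> j t > 0 \<Longrightarrow> \<exists>i::int. \<bar>t + of_int i * T - s j\<bar> < \<eta>"
    by auto
  define P where "P u t = (\<Sum>j<N. \<phi> j t * u j)" for u t
  \<comment> \<open>A convex combination of numbers close to \<open>c\<close> is close to
    \<open>c\<close>. This is used three times: with the midpoint \<open>R / 2\<close> to stay in
    the box, with \<open>c = 0\<close> for the dependence of \<open>P u\<close> on \<open>u\<close>,
    and with the value of \<open>\<Phi> (P u)\<close> for the final estimate.\<close>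
  have average: "\<bar>P u t - c\<bar> \<le> e" if "\<And>j. j < N \<Longrightarrow> \<phi> j t > 0 \<Longrightarrow> \<bar>u j - c\<bar> \<le> e" for u t c e
  proof -
    have "P u t - c = (\<Sum>j<N. \<phi> j t * (u j - c))"
      by (simp add: P_def right_diff_distrib sum_subtractf \<phi>(4) flip: sum_distrib_right)
    also have "\<bar>\<dots>\<bar> \<le> (\<Sum>j<N. \<phi> j t * e)"
    proof (intro order_trans[OF sum_abs] sum_mono)
      fix j assume "j \<in> {..<N}"
      then show "\<bar>\<phi> j t * (u j - c)\<bar> \<le> \<phi> j t * e"
        using that[of j] \<phi>(3)[of j t] by (cases "\<phi> j t = 0") (auto simp: abs_mult mult_left_mono)
    qed
    also have "\<dots> = e" by (simp add: \<phi>(4) flip: sum_distrib_right)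
    finally show ?thesis .
  qed
  have P_box: "P u \<in> periodic_box T R" if "\<forall>j<N. u j \<in> {0..R}" for u
  proof -
    have "continuous_on UNIV (P u)" unfolding P_def by (intro continuous_intros \<phi>)
    moreover have "periodic_fun_simple (P u) T"
    proof
      fix t show "P u (t + T) = P u t"
        using periodic_translate[OF \<phi>(2), of _ t 1] by (simp add: P_def)
    qed
    moreover have "P u t \<in> {0..R}" for t
    proof -
      have "\<bar>P u t - R / 2\<bar> \<le> R / 2"
      proof (rule average)
        fix j assume "j < N"
        then have "0 \<le> u j" "u j \<le> R" using that by auto
        then show "\<bar>u j - R / 2\<bar> \<le> R / 2" unfolding abs_le_iff by linarith
      qed
      then have "0 \<le> P u t" "P u t \<le> R" unfolding abs_le_iff by linarith+
      then show ?thesis by simp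
    qed
    ultimately show ?thesis by (simp add: periodic_box_def)
  qed
  have "\<exists>u. (\<forall>j<N. u j \<in> {0..R}) \<and> (\<forall>j<N. \<bar>\<Phi> (P u) (s j) - u j\<bar> \<le> \<epsilon> / 2)"
  proof (rule approximate_fixed_point_cube)
    show "\<forall>j<N. \<Phi> (P u) (s j) \<in> {0..R}" if "\<forall>j<N. u j \<in> {0..R}" for u
      using maps[OF P_box[OF that]] by (simp add: periodic_box_def)
    fix e :: real assume "e > 0"
    then obtain d where "d > 0" and d: "\<forall>x\<in>periodic_box T R. \<forall>y\<in>periodic_box T R.
                  (\<forall>t. \<bar>x t - y t\<bar> \<le> d) \<longrightarrow> (\<forall>t. \<bar>\<Phi> x t - \<Phi> y t\<bar> \<le> e)"
      using ucont by blast
    have "\<bar>\<Phi> (P u) t - \<Phi> (P v) t\<bar> \<le> e"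
      if uv: "\<forall>i<N. u i \<in> {0..R} \<and> v i \<in> {0..R} \<and> \<bar>u i - v i\<bar> \<le> d" for u v t
    proof -
      have "\<bar>P u t - P v t\<bar> \<le> d" for t
      proof -
        have "P u t - P v t = P (\<lambda>j. u j - v j) t - 0"
          by (simp add: P_def right_diff_distrib sum_subtractf)
        also have "\<bar>\<dots>\<bar> \<le> d" using uv by (intro average) auto
        finally show ?thesis .
      qed
      then show ?thesis using d P_box[of u] P_box[of v] uv by blast
    qed
    then show "\<exists>d>0. \<forall>u v. (\<forall>i<N. u i \<in> {0..R} \<and> v i \<in> {0..R} \<and> \<bar>u i - v i\<bar> \<le> d)
                  \<longrightarrow> (\<forall>i<N. \<bar>\<Phi> (P u) (s i) - \<Phi> (P v) (s i)\<bar> \<le> e)"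
      using \<open>d > 0\<close> by blast
  qed (use \<open>R > 0\<close> assms in auto)
  then obtain u where u: "\<forall>j<N. u j \<in> {0..R}" "\<forall>j<N. \<bar>\<Phi> (P u) (s j) - u j\<bar> \<le> \<epsilon> / 2" by blast
  have box: "P u \<in> periodic_box T R" using P_box u by blast
  have "\<bar>P u t - \<Phi> (P u) t\<bar> \<le> \<epsilon>" for t
  proof (rule average)
    fix j assume "j < N" "\<phi> j t > 0"
    then obtain i :: int where i: "\<bar>t + of_int i * T - s j\<bar> < \<eta>" using support by blast
    \<comment> \<open>The translate of \<open>t\<close> lies within \<eta> of the node, so the
      Lipschitz bound is applied there; periodicity then brings the value back to
      \<open>t\<close>.\<close>
    have "\<bar>\<Phi> (P u) (s j) - \<Phi> (P u) (t + of_int i * T)\<bar> \<le> L * \<bar>s j - (t + of_int i * T)\<bar>"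
      by (rule lipschitz[OF box])
    also have "\<dots> \<le> \<bar>L\<bar> * \<eta>" using i by (intro mult_mono) auto
    also note L\<eta>
    finally have "\<bar>\<Phi> (P u) (s j) - \<Phi> (P u) t\<bar> \<le> \<epsilon> / 2"
      using maps[OF box] by (simp add: periodic_box_def periodic_translate)
    then show "\<bar>u j - \<Phi> (P u) t\<bar> \<le> \<epsilon>" using u \<open>j < N\<close> by (smt (verit) field_sum_of_halves)
  qed
  then show ?thesis using box by (auto simp: abs_minus_commute)
qed

text \<open>The common Lipschitz constant makes the images of approximate fixed points
  equicontinuous, so it is the images that are handed to Arzela-Ascoli. Continuity of \<Phi> makes
  their limit a fixed point.\<close>

theorem periodic_box_fixed_point:
  obtains x where "x \<in> periodic_box T R" and "\<Phi> x = x"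
proof -
  have "\<forall>n. \<exists>x\<in>periodic_box T R. \<forall>t. \<bar>\<Phi> x t - x t\<bar> \<le> inverse (real (Suc n))"
    using periodic_box_approximate_fixed_point by simp
  then obtain x where x: "\<And>n. x n \<in> periodic_box T R"
    and x_approx: "\<And>n t. \<bar>\<Phi> (x n) t - x n t\<bar> \<le> inverse (real (Suc n))" by metis
  define z where "z n = \<Phi> (x n)" for n
  have z: "z n \<in> periodic_box T R" for n using maps x by (simp add: z_def)
  obtain g0 and k :: "nat \<Rightarrow> nat" where "strict_mono k"
    and conv0: "\<And>e. 0 < e \<Longrightarrow> \<exists>N. \<forall>n t. n \<ge> N \<and> t \<in> {0..T} \<longrightarrow> norm (z (k n) t - g0 t) < e"
  proof (rule Arzela_Ascoli[of "{0..T}" z R])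
    show "compact {0..T}" by simp
    show "norm (z n t) \<le> R" for n t using z[of n] by (auto simp: periodic_box_def abs_le_iff)
    fix t e :: real assume "e > 0"
    have "norm (z n t - z n t') < e" if "norm (t - t') < e / (\<bar>L\<bar> + 1)" for n t'
    proof -
      have "norm (z n t - z n t') \<le> L * \<bar>t - t'\<bar>" using lipschitz x by (simp add: z_def)
      also have "\<dots> \<le> (\<bar>L\<bar> + 1) * \<bar>t - t'\<bar>" by (intro mult_right_mono) auto
      also have "\<dots> < e" using that by (simp add: field_simps)
      finally show ?thesis .
    qed
    then show "\<exists>d>0. \<forall>n y. y \<in> {0..T} \<and> norm (t - y) < d \<longrightarrow> norm (z n t - z n y) < e"
      using \<open>e > 0\<close> by (intro exI[of _ "e / (\<bar>L\<bar> + 1)"]) auto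
  qed auto
  have "\<forall>t. \<exists>i::int. t + of_int i * T \<in> {0..T}"
    using translate_into_period[OF \<open>T > 0\<close>] by (metis add_0 atLeastAtMost_iff)
  then obtain i :: "real \<Rightarrow> int" where i: "\<And>t. t + of_int (i t) * T \<in> {0..T}" by metis
  \<comment> \<open>The limit \<open>g0\<close> is known on one period only and is extended by
    translation. Periodicity of \<open>g\<close> comes from the convergence, so it does not matter
    which translate is chosen at the endpoints.\<close>
  define g where "g t = g0 (t + of_int (i t) * T)" for t
  have conv: "\<exists>N. \<forall>n\<ge>N. \<forall>t. \<bar>z (k n) t - g t\<bar> < e" if "e > 0" for e
  proof -
    obtain N where N: "\<forall>n t. n \<ge> N \<and> t \<in> {0..T} \<longrightarrow> norm (z (k n) t - g0 t) < e"
      using conv0 \<open>e > 0\<close> by blast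
    have "\<bar>z (k n) t - g t\<bar> < e" if "n \<ge> N" for n t
      using N[rule_format, of n "t + of_int (i t) * T"] that i[of t] z[of "k n"]
      by (simp add: g_def periodic_box_def periodic_translate)
    then show ?thesis by blast
  qed
  have ulim: "uniform_limit UNIV (\<lambda>n. z (k n)) g sequentially"
    using conv by (simp add: uniform_limit_sequentially_iff dist_real_def)
  then have lim: "(\<lambda>n. z (k n) t) \<longlonglongrightarrow> g t" for t
    by (rule tendsto_uniform_limitI) simp
  have g: "g \<in> periodic_box T R"
  proof -
    have "continuous_on UNIV g"
      by (rule uniform_limit_theorem[OF _ ulim]) (use z in \<open>auto simp: periodic_box_def\<close>)
    moreover have "periodic_fun_simple g T"
    proof
      fix t
      have "z (k n) (t + T) = z (k n) t" for n
        using periodic_translate[of "z (k n)" T t 1] z by (simp add: periodic_box_def)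
      then show "g (t + T) = g t" using lim[of t] lim[of "t + T"] LIMSEQ_unique by simp
    qed
    moreover have "g t \<in> {0..R}" for t
      by (rule closed_sequentially[OF _ _ lim]) (use z in \<open>auto simp: periodic_box_def\<close>)
    ultimately show ?thesis by (simp add: periodic_box_def)
  qed
  have "\<Phi> g t = g t" for t
  proof -
    \<comment> \<open>Both \<open>x (k n)\<close> and its image \<open>z (k n)\<close> are close to
      \<open>g\<close> for large \<open>n\<close>; the image is therefore also close to
      \<open>\<Phi> g\<close>.\<close>
    have "\<bar>\<Phi> g t - g t\<bar> \<le> e + e" if "e > 0" for e
    proof -
      obtain d where "d > 0" and d: "\<forall>x\<in>periodic_box T R. \<forall>y\<in>periodic_box T R.
                  (\<forall>t. \<bar>x t - y t\<bar> \<le> d) \<longrightarrow> (\<forall>t. \<bar>\<Phi> x t - \<Phi> y t\<bar> \<le> e)"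
        using ucont \<open>e > 0\<close> by blast
      obtain N where N: "\<forall>n\<ge>N. \<forall>t. \<bar>z (k n) t - g t\<bar> < min e (d/2)"
        using conv[of "min e (d/2)"] \<open>e > 0\<close> \<open>d > 0\<close> by auto
      obtain N' where N': "inverse (real (Suc N')) < d / 2"
        using reals_Archimedean[of "d/2"] \<open>d > 0\<close> by auto
      define n where "n = max N N'"
      have "inverse (real (Suc (k n))) \<le> inverse (real (Suc N'))"
        using seq_suble[OF \<open>strict_mono k\<close>, of n] by (simp add: n_def)
      then have "\<bar>z (k n) s - x (k n) s\<bar> \<le> d / 2" for s
        using x_approx[of "k n" s] N' by (simp only: z_def)
      moreover have zg: "\<bar>z (k n) s - g s\<bar> < min e (d/2)" for s using N by (simp add: n_def)
      ultimately have "\<bar>x (k n) s - g s\<bar> \<le> d" for s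
        by (smt (verit) field_sum_of_halves)
      then have "\<bar>z (k n) t - \<Phi> g t\<bar> \<le> e" using d x g by (simp add: z_def)
      then show ?thesis using zg[of t] by linarith
    qed
    then have "\<bar>\<Phi> g t - g t\<bar> \<le> 0 + e" if "e > 0" for e
      using that by (metis add_0 field_sum_of_halves half_gt_zero)
    then have "\<bar>\<Phi> g t - g t\<bar> \<le> 0" by (rule field_le_epsilon)
    then show ?thesis by simp
  qed
  then show ?thesis using g that by blast
qed

end

subsection \<open>Periodic solutions of the linear equation\<close>

text \<open>\<open>B\<close> is an antiderivative of \<open>b\<close>, so \<open>exp (B t)\<close>
  is the integrating factor of \<open>z' = h - b z\<close>, and \<open>C\<close> is the integral of
  \<open>b\<close> over a period.\<close>

locale periodic_decay =
  fixes T C :: real and b B :: "real \<Rightarrow> real"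
  assumes C_pos: "C > 0" and T_pos: "T > 0" and b_pos: "\<And>t. b t > 0"
    and B_deriv: "\<And>t. (B has_real_derivative b t) (at t)"
    and B_shift: "\<And>t. B (t + T) = B t + C"
begin

text \<open>Variation of constants: with \<open>E\<close> an antiderivative of
  \<open>h t * exp (B t)\<close>, every \<open>exp (- B t) * (E t + c)\<close> is a solution, and
  one value of \<open>c\<close> makes it periodic.\<close>

lemma periodic_solution_exists:
  assumes h_cont: "continuous_on UNIV h" and h_per: "periodic_fun_simple h T"
  obtains z where "periodic_fun_simple z T"
    and "\<And>t. (z has_real_derivative h t - b t * z t) (at t)"
proof -
  have B_cont: "continuous_on UNIV B"
    using B_deriv by (meson DERIV_isCont continuous_at_imp_continuous_on)
  have "isCont (\<lambda>t. h t * exp (B t)) t" for t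
    using h_cont B_cont by (auto simp: continuous_on_eq_continuous_at intro!: continuous_intros)
  then obtain E where "\<forall>t::real. (E has_vector_derivative h t * exp (B t)) (at t)"
    using einterval_antiderivative[of "-\<infinity>" \<infinity> "\<lambda>t. h t * exp (B t)"] by auto
  then have E: "(E has_real_derivative h t * exp (B t)) (at t)" for t
    by (simp add: has_real_derivative_iff_has_vector_derivative)
  have h_shift: "h (t + T) = h t" for t using periodic_translate[OF h_per, of t 1] by simp
  have "((\<lambda>t. E (t + T) - exp C * E t) has_real_derivative 0) (at t)" for t
  proof -
    have "((\<lambda>t. E (t + T)) has_real_derivative h (t + T) * exp (B (t + T))) (at t)"
      using E DERIV_shift by blast
    then have "((\<lambda>t. E (t + T) - exp C * E t) has_real_derivative
        h (t + T) * exp (B (t + T)) - exp C * (h t * exp (B t))) (at t)"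
      by (intro DERIV_diff DERIV_cmult E)
    then show ?thesis by (simp add: h_shift B_shift exp_add)
  qed
  then have const: "E (t + T) - exp C * E t = E (0 + T) - exp C * E 0" for t
    using DERIV_isconst_all by blast
  \<comment> \<open>The solution of \<open>E T + c = exp C * (E 0 + c)\<close>, the condition that
    the solution takes the same value at 0 and \<open>T\<close>; it exists because
    \<open>exp C\<close> differs from 1.\<close>
  define c where "c = (E T - exp C * E 0) / (exp C - 1)"
  have "exp C - 1 > 0" using C_pos by simp
  then have "c * (exp C - 1) = E T - exp C * E 0" by (simp add: c_def)
  then have step: "E (t + T) = exp C * (E t + c) - c" for t
    using const[of t] by (simp add: algebra_simps)
  show ?thesis
  proof (rule that[of "\<lambda>t. exp (- B t) * (E t + c)"])
    show "periodic_fun_simple (\<lambda>t. exp (- B t) * (E t + c)) T"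
      by unfold_locales (simp add: step B_shift exp_add exp_diff exp_minus field_simps)
    show "((\<lambda>t. exp (- B t) * (E t + c)) has_real_derivative h t - b t * (exp (- B t) * (E t + c))) (at t)" for t
      by (auto intro!: derivative_eq_intros E B_deriv simp: exp_minus field_simps)
  qed
qed

text \<open>The derivative of \<open>exp (B t) * z t\<close> is
  \<open>exp (B t) * h t\<close>.\<close>

lemma weighted_mono:
  assumes "\<And>t. (z has_real_derivative h t - b t * z t) (at t)" and "\<And>t. h t \<ge> 0" and "s \<le> t"
  shows "exp (B s) * z s \<le> exp (B t) * z t"
proof (rule DERIV_nonneg_imp_nondecreasing[OF \<open>s \<le> t\<close>], intro exI conjI)
  fix u
  show "((\<lambda>t. exp (B t) * z t) has_real_derivative exp (B u) * h u) (at u)"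
    by (auto intro!: derivative_eq_intros assms(1) B_deriv simp: algebra_simps)
  show "0 \<le> exp (B u) * h u" using assms(2) by simp
qed

text \<open>Monotonicity of the weighted solution over one period gives
  \<open>z t \<le> exp C * z t\<close>, and \<open>exp C > 1\<close>.\<close>

lemma periodic_solution_nonneg:
  assumes z: "periodic_fun_simple z T" "\<And>t. (z has_real_derivative h t - b t * z t) (at t)"
    and h: "\<And>t. h t \<ge> 0"
  shows "z t \<ge> 0"
proof -
  have "exp (B t) * z t \<le> exp (B (t + T)) * z (t + T)"
    by (rule weighted_mono[OF z(2) h]) (use T_pos in auto)
  then have "z t \<le> exp C * z t"
    using periodic_translate[OF z(1), of t 1] by (simp add: B_shift exp_add)
  then have "(exp C - 1) * z t \<ge> 0" by (simp add: algebra_simps)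
  then show ?thesis using C_pos by (simp add: zero_le_mult_iff)
qed

text \<open>By periodicity \<open>t\<close> may be moved into the period that starts at
  \<open>s\<close>. There the weighted solution has not decreased since \<open>s\<close>, while the
  weight has grown by a factor of at most \<open>exp C\<close>.\<close>

lemma periodic_solution_Harnack:
  assumes z: "periodic_fun_simple z T" "\<And>t. (z has_real_derivative h t - b t * z t) (at t)"
    and h: "\<And>t. h t \<ge> 0"
  shows "exp (-C) * z s \<le> z t"
proof -
  obtain j :: int where j: "s \<le> t + of_int j * T" "t + of_int j * T \<le> s + T"
    using translate_into_period[OF T_pos] by metis
  define u where "u = t + of_int j * T"
  have "z u = z t" using z(1) by (simp add: u_def periodic_translate)
  have "B u \<le> B (s + T)"
    by (rule DERIV_nonneg_imp_nondecreasing[of u "s + T" B])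
       (use j b_pos B_deriv in \<open>auto simp: u_def intro: less_imp_le\<close>)
  then have "exp (B u) \<le> exp (B s) * exp C" by (simp add: B_shift flip: exp_add)
  have "exp (B s) * z s \<le> exp (B u) * z u"
    by (rule weighted_mono[OF z(2) h]) (use j in \<open>auto simp: u_def\<close>)
  also have "\<dots> \<le> (exp (B s) * exp C) * z u"
    using \<open>exp (B u) \<le> _\<close> periodic_solution_nonneg[OF z h] by (intro mult_right_mono) auto
  finally show ?thesis by (simp add: \<open>z u = z t\<close> exp_minus field_simps)
qed

text \<open>The difference \<open>z - y - c\<close> solves the linear equation with nonnegative
  forcing. Comparison with constants gives the bounds by \<open>R\<close> and \<open>p\<close>; a
  negative \<open>c\<close> gives the continuous dependence on the forcing.\<close>

lemma periodic_solution_ge: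
  assumes "periodic_fun_simple z T" "\<And>t. (z has_real_derivative h t - b t * z t) (at t)"
    and "periodic_fun_simple y T" "\<And>t. (y has_real_derivative g t - b t * y t) (at t)"
    and "\<And>t. g t + c * b t \<le> h t"
  shows "y t + c \<le> z t"
proof -
  have "z t - y t - c \<ge> 0"
  proof (rule periodic_solution_nonneg[where z = "\<lambda>t. z t - y t - c" and h = "\<lambda>t. h t - g t - c * b t"])
    show "periodic_fun_simple (\<lambda>t. z t - y t - c) T"
      using periodic_translate[OF assms(1), of _ 1] periodic_translate[OF assms(3), of _ 1]
      by unfold_locales simp
    show "((\<lambda>t. z t - y t - c) has_real_derivative h t - g t - c * b t - b t * (z t - y t - c)) (at t)" for t
      by (auto intro!: derivative_eq_intros assms simp: algebra_simps)
  qed (use assms(5) in \<open>simp add: algebra_simps\<close>)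
  then show ?thesis by simp
qed

lemma constant_solution:
  "periodic_fun_simple (\<lambda>_. c) T" "((\<lambda>_. c) has_real_derivative c * b t - b t * c) (at t)"
  by (unfold_locales) (auto simp: mult.commute)

end

subsection \<open>The truncated nonlinearity\<close>

lemma uniform_delta_finite:
  fixes P :: "'a \<Rightarrow> real \<Rightarrow> bool"
  assumes "finite I" and "\<And>i. i \<in> I \<Longrightarrow> \<exists>d>0. P i d" and "\<And>i d d'. P i d \<Longrightarrow> d' \<le> d \<Longrightarrow> P i d'"
  shows "\<exists>d>0. \<forall>i\<in>I. P i d"
  using assms(1,2)
proof (induction I)
  case empty
  show ?case by (auto intro: exI[of _ 1])
next
  case (insert i I)
  obtain d1 where "d1 > 0" "P i d1" using insert.prems by blast
  moreover obtain d2 where "d2 > 0" "\<forall>i\<in>I. P i d2" using insert.IH insert.prems by blast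
  ultimately have "min d1 d2 > 0 \<and> (\<forall>i\<in>insert i I. P i (min d1 d2))"
    using assms(3) by (auto intro: min.cobounded1 min.cobounded2)
  then show ?case by blast
qed

text \<open>This is where \<open>m k < n k + 1\<close> enters: with \<open>q = m k - n k\<close> it
  makes the bound on the truncated feedback sublinear in \<open>R\<close>.\<close>

lemma powr_plus_const_over_self_tendsto_0:
  fixes q c :: real
  assumes "q < 1"
  shows "((\<lambda>R. (R powr q + c) / R) \<longlongrightarrow> 0) at_top"
proof -
  have "((\<lambda>R. R powr (q - 1) + c / R) \<longlongrightarrow> 0 + 0) at_top"
    using assms by (intro tendsto_add tendsto_neg_powr tendsto_divide_0[OF tendsto_const]
        filterlim_at_top_imp_at_infinity filterlim_ident) auto
  moreover have "\<forall>\<^sub>F R in at_top. R powr (q - 1) + c / R = (R powr q + c) / R"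
    using eventually_gt_at_top[of 0]
    by eventually_elim (simp add: powr_diff add_divide_distrib)
  ultimately show ?thesis by (simp add: tendsto_cong)
qed

text \<open>
  The second maximum is inactive at functions satisfying the Harnack inequality with constant \<open>\<sigma>\<close>,
  but bounds the feedback by a multiple of \<open>u powr (m - n)\<close> elsewhere in the order interval.
\<close>

definition feedback :: "real \<Rightarrow> real \<Rightarrow> real \<Rightarrow> real \<Rightarrow> real \<Rightarrow> real \<Rightarrow> real" where
  "feedback p \<sigma> m n u v = max p u powr m / (1 + max (max p v) (\<sigma> * max p u) powr n)"

lemma feedback_nonneg: "feedback p \<sigma> m n u v \<ge> 0"
  by (simp add: feedback_def add_nonneg_nonneg)

lemma feedback_continuous:
  assumes "p > 0" and "continuous_on S f" and "continuous_on S g"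
  shows "continuous_on S (\<lambda>x. feedback p \<sigma> m n (f x) (g x))"
proof -
  have "1 + max (max p v) (\<sigma> * max p u) powr n \<noteq> 0" for u v
    by (smt (verit) powr_ge_zero)
  moreover have "max (max p v) (\<sigma> * max p u) \<noteq> 0" "max p u \<noteq> 0" for u v using \<open>p > 0\<close> by auto
  ultimately show ?thesis
    unfolding feedback_def by (intro continuous_intros assms) auto
qed

text \<open>With \<open>a = max p u\<close>, the denominator is at least
  \<open>(\<sigma> * a) powr n\<close>, which leaves a multiple of \<open>a powr (m - n)\<close>.
  This power is monotone in \<open>a\<close>, in a direction that depends on the sign of
  \<open>m - n\<close>, so the sum of its values at \<open>p\<close> and \<open>R\<close> bounds it
  in either case.\<close>

lemma feedback_upper:
  assumes "p > 0" "\<sigma> > 0" "n > 0" and "u \<le> R" "p \<le> R"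
  shows "feedback p \<sigma> m n u v \<le> \<sigma> powr (-n) * (R powr (m - n) + p powr (m - n))"
proof -
  define a where "a = max p u"
  have a: "p \<le> a" "a \<le> R" "a > 0" using assms by (auto simp: a_def)
  have "feedback p \<sigma> m n u v \<le> a powr m / (\<sigma> * a) powr n"
    unfolding feedback_def a_def[symmetric]
  proof (rule frac_le)
    have "(\<sigma> * a) powr n \<le> max (max p v) (\<sigma> * a) powr n"
      using assms a by (intro powr_mono2) auto
    then show "(\<sigma> * a) powr n \<le> 1 + max (max p v) (\<sigma> * a) powr n" by simp
  qed (use assms a in auto)
  also have "\<dots> = \<sigma> powr (-n) * a powr (m - n)"
    using assms a by (simp add: powr_mult powr_diff powr_minus field_simps)
  also have "a powr (m - n) \<le> R powr (m - n) + p powr (m - n)"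
  proof (cases "m \<ge> n")
    case True
    then have "a powr (m - n) \<le> R powr (m - n)" using a by (intro powr_mono2) auto
    then show ?thesis by (simp add: add_increasing2)
  next
    case False
    then have "a powr (m - n) \<le> p powr (m - n)" using a \<open>p > 0\<close> by (intro powr_mono2') auto
    then show ?thesis by (simp add: add_increasing)
  qed
  then have "\<sigma> powr (-n) * a powr (m - n) \<le> \<sigma> powr (-n) * (R powr (m - n) + p powr (m - n))"
    by (intro mult_left_mono) auto
  finally show ?thesis .
qed

text \<open>The numerator is at least \<open>p powr m\<close>, and every quantity inside the maximum
  of the denominator is at most \<open>p / \<sigma>\<close>.\<close>

lemma feedback_lower:
  assumes "p > 0" "\<sigma> > 0" "\<sigma> \<le> 1" "m \<ge> 0" "n \<ge> 0" and "\<sigma> * u \<le> p" "\<sigma> * v \<le> p"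
  shows "p powr m / (1 + (p / \<sigma>) powr n) \<le> feedback p \<sigma> m n u v"
proof -
  have "\<sigma> * p \<le> p" using assms by simp
  then have "p \<le> p / \<sigma>" "u \<le> p / \<sigma>" "v \<le> p / \<sigma>" using assms by (simp_all add: field_simps)
  moreover have "\<sigma> * max p u \<le> p" using \<open>\<sigma> * p \<le> p\<close> assms by (simp add: max_def)
  ultimately have "max (max p v) (\<sigma> * max p u) \<le> p / \<sigma>" by linarith
  then have "max (max p v) (\<sigma> * max p u) powr n \<le> (p / \<sigma>) powr n"
    using assms by (intro powr_mono2) auto
  moreover have "p powr m \<le> max p u powr m" using assms by (intro powr_mono2) auto
  ultimately show ?thesis
    unfolding feedback_def by (intro frac_le) (auto simp: add_pos_nonneg)
qed

lemma feedback_eq: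
  assumes "p \<le> u" "p \<le> v" "\<sigma> * u \<le> v"
  shows "feedback p \<sigma> m n u v = u powr m / (1 + v powr n)"
  using assms by (simp add: feedback_def max_def)

lemma feedback_uniformly_continuous:
  assumes "p > 0" and "e > 0"
  shows "\<exists>d>0. \<forall>u\<in>{0..R}. \<forall>v\<in>{0..R}. \<forall>u'\<in>{0..R}. \<forall>v'\<in>{0..R}. \<bar>u - u'\<bar> \<le> d \<longrightarrow> \<bar>v - v'\<bar> \<le> d \<longrightarrow>
           \<bar>feedback p \<sigma> m n u v - feedback p \<sigma> m n u' v'\<bar> \<le> e"
proof -
  define S where "S = {0..R} \<times> {0..R}"
  have "continuous_on S (\<lambda>x. feedback p \<sigma> m n (fst x) (snd x))"
    by (intro feedback_continuous continuous_intros assms)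
  then have "uniformly_continuous_on S (\<lambda>x. feedback p \<sigma> m n (fst x) (snd x))"
    by (intro compact_uniformly_continuous) (auto simp: S_def compact_Times)
  then obtain d where "d > 0" and
    d: "\<forall>x\<in>S. \<forall>x'\<in>S. dist x' x < d \<longrightarrow> dist (feedback p \<sigma> m n (fst x') (snd x')) (feedback p \<sigma> m n (fst x) (snd x)) < e"
    unfolding uniformly_continuous_on_def using \<open>e > 0\<close> by blast
  \<comment> \<open>Two coordinate errors of \<open>d/3\<close> keep the distance of the pairs
    strictly below \<open>d\<close>.\<close>
  have "\<bar>feedback p \<sigma> m n u v - feedback p \<sigma> m n u' v'\<bar> \<le> e"
    if "u \<in> {0..R}" "v \<in> {0..R}" "u' \<in> {0..R}" "v' \<in> {0..R}" "\<bar>u - u'\<bar> \<le> d/3" "\<bar>v - v'\<bar> \<le> d/3" for u v u' v'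
  proof -
    have "dist (u, v) (u', v') \<le> \<bar>u - u'\<bar> + \<bar>v - v'\<bar>"
      by (simp add: dist_Pair_Pair dist_real_def sqrt_sum_squares_le_sum_abs)
    also have "\<dots> < d" using that \<open>d > 0\<close> by simp
    finally have "dist (feedback p \<sigma> m n u v) (feedback p \<sigma> m n u' v') < e"
      using d[rule_format, of "(u', v')" "(u, v)"] that by (simp add: S_def)
    then show ?thesis by (simp add: dist_real_def)
  qed
  then show ?thesis using \<open>d > 0\<close> by (intro exI[of _ "d/3"]) auto
qed

section \<open>Existence of a solution from a lower level\<close>

lemma coefficient_function_shift:
  assumes "coefficient_function T f"
  shows "f (t + T) = f t"
  using assms periodic_translate[of f T t 1] by (simp add: coefficient_function_def)

text \<open>The assumption on \<open>p\<close> says that the production term dominates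
  \<open>p * b t\<close> even in the worst case, with \<open>p\<close> in every numerator and
  \<open>p * exp C\<close> in every denominator.\<close>

theorem delay_equation_positive_periodic_solution:
  fixes T C p :: real and I :: "'a set"
    and lam m n :: "'a \<Rightarrow> real"
    and r \<tau> \<mu> :: "'a \<Rightarrow> real \<Rightarrow> real"
    and b :: "real \<Rightarrow> real"
  assumes "T > 0" and "finite I"
    and pos: "\<And>k. k \<in> I \<Longrightarrow> lam k > 0 \<and> m k > 0 \<and> n k > 0 \<and> m k < n k + 1"
    and r: "\<And>k. k \<in> I \<Longrightarrow> coefficient_function T (r k)"
    and \<tau>: "\<And>k. k \<in> I \<Longrightarrow> coefficient_function T (\<tau> k)"
    and \<mu>: "\<And>k. k \<in> I \<Longrightarrow> coefficient_function T (\<mu> k)"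
    and b: "coefficient_function T b"
    and C: "C = integral {0..T} b"
    and "p > 0" and p: "\<And>t. p * b t \<le> (\<Sum>k\<in>I. lam k * r k t * (p powr m k / (1 + (p * exp C) powr n k)))"
  shows "\<exists>x. (\<forall>t. x t > 0) \<and> periodic_fun_simple x T \<and>
     (\<forall>t. (x has_real_derivative
            (\<Sum>k\<in>I. lam k * r k t *
               (x (t - \<tau> k t) powr m k / (1 + x (t - \<mu> k t) powr n k))) - b t * x t) (at t))"
proof -
  have b_cont: "continuous_on UNIV b" and b_pos: "b t > 0" and b_per: "periodic_fun_simple b T" for t
    using b by (auto simp: coefficient_function_def)
  obtain ub vb where ub: "\<And>t. b ub \<le> b t" and vb: "\<And>t. b t \<le> b vb"
    using periodic_attains_bounds[OF \<open>T > 0\<close> b_cont b_per] by blast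
  have "\<exists>v. \<forall>t. r k t \<le> r k v" if "k \<in> I" for k
    using periodic_attains_bounds[OF \<open>T > 0\<close>, of "r k"] r[OF that] unfolding coefficient_function_def by metis
  then obtain vr where vr: "\<And>k t. k \<in> I \<Longrightarrow> r k t \<le> r k (vr k)" by metis
  have r_pos: "r k t > 0" if "k \<in> I" for k t using r[OF that] by (simp add: coefficient_function_def)
  have r_nonneg: "0 \<le> lam k * r k t" if "k \<in> I" for k t using pos[OF that] r_pos[OF that, of t] by simp

  obtain B where B: "\<And>t. (B has_real_derivative b t) (at t)"
  proof -
    have "\<exists>B. \<forall>t::real. (B has_vector_derivative b t) (at t)"
      using einterval_antiderivative[of "-\<infinity>" \<infinity> b] b_cont by (auto simp: continuous_on_eq_continuous_at)
    then show ?thesis using that by (auto simp: has_real_derivative_iff_has_vector_derivative)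
  qed
  have "(b has_integral B T - B 0) {0..T}"
    using \<open>T > 0\<close> B by (intro fundamental_theorem_of_calculus)
      (auto simp: has_real_derivative_iff_has_vector_derivative intro: has_vector_derivative_at_within)
  then have C_eq: "C = B T - B 0" using C by (simp add: integral_unique)
  have B_shift: "B (t + T) = B t + C" for t
  proof -
    have "((\<lambda>t. B (t + T) - B t) has_real_derivative 0) (at t)" for t
    proof -
      have "((\<lambda>t. B (t + T)) has_real_derivative b (t + T)) (at t)"
        using B DERIV_shift by blast
      then have "((\<lambda>t. B (t + T) - B t) has_real_derivative b (t + T) - b t) (at t)"
        by (intro DERIV_diff B)
      then show ?thesis using periodic_translate[OF b_per, of t 1] by simp
    qed
    then have "B (t + T) - B t = B (0 + T) - B 0" using DERIV_isconst_all by blast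
    then show ?thesis by (simp add: C_eq)
  qed
  have "C > 0"
    using DERIV_pos_imp_increasing[OF \<open>T > 0\<close>, of B] B b_pos by (auto simp: C_eq)
  interpret periodic_decay T C b B
    using \<open>C > 0\<close> \<open>T > 0\<close> b_pos B B_shift by unfold_locales auto
  define \<sigma> where "\<sigma> = exp (-C)"
  have \<sigma>: "0 < \<sigma>" "\<sigma> \<le> 1" using \<open>C > 0\<close> by (simp_all add: \<sigma>_def)
  define H where "H x t = (\<Sum>k\<in>I. lam k * r k t * feedback p \<sigma> (m k) (n k) (x (t - \<tau> k t)) (x (t - \<mu> k t)))" for x t

  \<comment> \<open>The left side bounds the truncated production term from above, with each
    \<open>r k\<close> at its maximum. Divided by \<open>R\<close> it tends to 0, hence eventually
    lies below \<open>b ub\<close>, the minimum of \<open>b\<close>.\<close>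
  obtain R where "R > p" and R: "(\<Sum>k\<in>I. lam k * r k (vr k) * (\<sigma> powr (- n k) * (R powr (m k - n k) + p powr (m k - n k)))) \<le> R * b ub"
  proof -
    have "((\<lambda>R. (\<Sum>k\<in>I. lam k * r k (vr k) * (\<sigma> powr (- n k) * ((R powr (m k - n k) + p powr (m k - n k)) / R)))) \<longlongrightarrow>
        (\<Sum>k\<in>I. lam k * r k (vr k) * (\<sigma> powr (- n k) * 0))) at_top"
    proof (intro tendsto_intros)
      fix k assume "k \<in> I"
      then have "m k - n k < 1" using pos by force
      then show "((\<lambda>R. (R powr (m k - n k) + p powr (m k - n k)) / R) \<longlongrightarrow> 0) at_top"
        by (rule powr_plus_const_over_self_tendsto_0)
    qed
    then have "\<forall>\<^sub>F R in at_top. (\<Sum>k\<in>I. lam k * r k (vr k) * (\<sigma> powr (- n k) * ((R powr (m k - n k) + p powr (m k - n k)) / R))) < b ub"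
      using b_pos by (intro order_tendstoD(2)) auto
    then have "\<forall>\<^sub>F R in at_top. (\<Sum>k\<in>I. lam k * r k (vr k) * (\<sigma> powr (- n k) * ((R powr (m k - n k) + p powr (m k - n k)) / R))) < b ub
        \<and> R > p"
      using eventually_gt_at_top by (rule eventually_conj)
    then obtain R where "R > p" and
      "(\<Sum>k\<in>I. lam k * r k (vr k) * (\<sigma> powr (- n k) * ((R powr (m k - n k) + p powr (m k - n k)) / R))) < b ub"
      using eventually_happens trivial_limit_at_top_linorder by blast
    moreover from this have "(\<Sum>k\<in>I. lam k * r k (vr k) * (\<sigma> powr (- n k) * (R powr (m k - n k) + p powr (m k - n k)))) / R < b ub"
      by (simp add: sum_divide_distrib)
    ultimately show ?thesis using \<open>p > 0\<close> that[of R] by (simp add: field_simps)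
  qed
  have "R > 0" using \<open>R > p\<close> \<open>p > 0\<close> by simp
  have H_nonneg: "H x t \<ge> 0" for x t
    unfolding H_def by (intro sum_nonneg mult_nonneg_nonneg r_nonneg feedback_nonneg)
  have H_upper: "H x t \<le> R * b t" if "x \<in> periodic_box T R" for x t
  proof -
    have "H x t \<le> (\<Sum>k\<in>I. lam k * r k (vr k) * (\<sigma> powr (- n k) * (R powr (m k - n k) + p powr (m k - n k))))"
      unfolding H_def
    proof (rule sum_mono)
      fix k assume "k \<in> I"
      have "x (t - \<tau> k t) \<le> R" using that by (simp add: periodic_box_def)
      then have "feedback p \<sigma> (m k) (n k) (x (t - \<tau> k t)) (x (t - \<mu> k t))
          \<le> \<sigma> powr (- n k) * (R powr (m k - n k) + p powr (m k - n k))"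
        using \<sigma> \<open>R > p\<close> \<open>p > 0\<close> pos[OF \<open>k \<in> I\<close>] by (intro feedback_upper) auto
      moreover have "lam k * r k t \<le> lam k * r k (vr k)" using vr pos \<open>k \<in> I\<close> by simp
      ultimately show "lam k * r k t * feedback p \<sigma> (m k) (n k) (x (t - \<tau> k t)) (x (t - \<mu> k t))
          \<le> lam k * r k (vr k) * (\<sigma> powr (- n k) * (R powr (m k - n k) + p powr (m k - n k)))"
        by (metis mult_mono r_nonneg[OF \<open>k \<in> I\<close>] feedback_nonneg)
    qed
    also have "\<dots> \<le> R * b ub" by (rule R)
    also have "\<dots> \<le> R * b t" using ub \<open>R > 0\<close> by simp
    finally show ?thesis .
  qed
  have H_cont: "continuous_on UNIV (H x)" if "x \<in> periodic_box T R" for x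
  proof -
    have x: "continuous_on S x" for S using that by (auto simp: periodic_box_def intro: continuous_on_subset)
    show ?thesis
      unfolding H_def using r \<tau> \<mu> \<open>p > 0\<close>
      by (intro continuous_intros feedback_continuous continuous_on_compose2[OF x[of UNIV]])
        (auto simp: coefficient_function_def)
  qed
  have H_per: "periodic_fun_simple (H x) T" if "x \<in> periodic_box T R" for x
  proof
    fix t
    have x: "x (s + T) = x s" for s using that periodic_translate[of x T s 1] by (simp add: periodic_box_def)
    have "x (t + T - s) = x (t - s)" for s using x[of "t - s"] by (simp add: algebra_simps)
    then show "H x (t + T) = H x t"
      unfolding H_def using r \<tau> \<mu> by (intro sum.cong) (simp_all add: coefficient_function_shift)
  qed
  have "\<exists>z. periodic_fun_simple z T \<and> (\<forall>t. (z has_real_derivative H x t - b t * z t) (at t))"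
    if "x \<in> periodic_box T R" for x
    using periodic_solution_exists[OF H_cont[OF that] H_per[OF that]] by metis
  then obtain \<Phi> where \<Phi>_per: "\<And>x. x \<in> periodic_box T R \<Longrightarrow> periodic_fun_simple (\<Phi> x) T"
    and \<Phi>_deriv: "\<And>x t. x \<in> periodic_box T R \<Longrightarrow> (\<Phi> x has_real_derivative H x t - b t * \<Phi> x t) (at t)"
    by metis
  have \<Phi>_box: "\<Phi> x \<in> periodic_box T R" if x: "x \<in> periodic_box T R" for x
  proof -
    have "0 \<le> \<Phi> x t" for t
      by (rule periodic_solution_nonneg[OF \<Phi>_per[OF x] \<Phi>_deriv[OF x] H_nonneg])
    \<comment> \<open>The constant \<open>R\<close> solves the linear equation with forcing
      \<open>R * b t\<close>, which dominates \<open>H x t\<close>.\<close>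
    moreover have "\<Phi> x t + 0 \<le> R" for t
      by (rule periodic_solution_ge[OF constant_solution \<Phi>_per[OF x] \<Phi>_deriv[OF x]])
        (use H_upper[OF x] in auto)
    moreover have "continuous_on UNIV (\<Phi> x)"
      using \<Phi>_deriv[OF x] by (meson DERIV_isCont continuous_at_imp_continuous_on)
    ultimately show ?thesis using \<Phi>_per[OF x] by (simp add: periodic_box_def)
  qed
  obtain x where x: "x \<in> periodic_box T R" and fixed: "\<Phi> x = x"
  proof (rule periodic_box_fixed_point[OF \<open>T > 0\<close> \<open>R > 0\<close> \<Phi>_box])
    \<comment> \<open>At time \<open>u\<close> both terms of the derivative lie between 0 and
      \<open>R * b u\<close>, so their difference is at most \<open>R * b vb\<close>, where
      \<open>b vb\<close> is the maximum of \<open>b\<close>.\<close>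
    show "\<bar>\<Phi> x s - \<Phi> x t\<bar> \<le> (R * b vb) * \<bar>s - t\<bar>" if x: "x \<in> periodic_box T R" for x s t
    proof -
      have "norm (\<Phi> x s - \<Phi> x t) \<le> (R * b vb) * norm (s - t)"
      proof (rule field_differentiable_bound[of UNIV])
        fix u
        show "(\<Phi> x has_field_derivative H x u - b u * \<Phi> x u) (at u within UNIV)"
          using \<Phi>_deriv[OF x] by simp
        have \<Phi>: "0 \<le> \<Phi> x u" "\<Phi> x u \<le> R" using \<Phi>_box[OF x] by (simp_all add: periodic_box_def)
        have "0 \<le> b u * \<Phi> x u" "b u * \<Phi> x u \<le> b u * R"
          using \<Phi> b_pos[of u] by (simp_all add: mult_left_mono)
        moreover have "0 \<le> H x u" "H x u \<le> R * b u" by (fact H_nonneg, fact H_upper[OF x])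
        ultimately have "\<bar>H x u - b u * \<Phi> x u\<bar> \<le> R * b u" by (simp add: abs_le_iff mult.commute)
        also have "\<dots> \<le> R * b vb" using vb \<open>R > 0\<close> by simp
        finally show "norm (H x u - b u * \<Phi> x u) \<le> R * b vb" by simp
      qed auto
      then show ?thesis by simp
    qed
    fix e :: real assume "e > 0"
    define S where "S = (\<Sum>k\<in>I. lam k * r k (vr k))"
    have "S \<ge> 0" unfolding S_def by (intro sum_nonneg r_nonneg)
    \<comment> \<open>Feedback errors of \<open>e'\<close> change the production term by at most
      \<open>e * b t\<close>, and comparison then changes the solution by at most \<open>e\<close>.
      Adding 1 avoids division by zero when \<open>S = 0\<close>.\<close>
    define e' where "e' = e * b ub / (S + 1)"
    have "e' > 0" using \<open>e > 0\<close> \<open>S \<ge> 0\<close> b_pos by (simp add: e'_def)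
    have "S * e' \<le> (S + 1) * e'" using \<open>e' > 0\<close> by simp
    also have "\<dots> = e * b ub" using \<open>S \<ge> 0\<close> by (simp add: e'_def)
    finally have Se': "S * e' \<le> e * b ub" .
    define close where "close k d \<longleftrightarrow>
        (\<forall>u\<in>{0..R}. \<forall>v\<in>{0..R}. \<forall>u'\<in>{0..R}. \<forall>v'\<in>{0..R}. \<bar>u - u'\<bar> \<le> d \<longrightarrow> \<bar>v - v'\<bar> \<le> d \<longrightarrow>
           \<bar>feedback p \<sigma> (m k) (n k) u v - feedback p \<sigma> (m k) (n k) u' v'\<bar> \<le> e')" for k d
    have "close k d'" if "close k d" "d' \<le> d" for k d d'
      unfolding close_def
    proof (intro ballI impI)
      fix u v u' v' assume "u \<in> {0..R}" "v \<in> {0..R}" "u' \<in> {0..R}" "v' \<in> {0..R}" "\<bar>u - u'\<bar> \<le> d'" "\<bar>v - v'\<bar> \<le> d'"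
      then show "\<bar>feedback p \<sigma> (m k) (n k) u v - feedback p \<sigma> (m k) (n k) u' v'\<bar> \<le> e'"
        using that by (intro \<open>close k d\<close>[unfolded close_def, rule_format]) linarith+
    qed
    moreover have "\<exists>d>0. close k d" for k
      unfolding close_def by (rule feedback_uniformly_continuous[OF \<open>p > 0\<close> \<open>e' > 0\<close>])
    ultimately obtain d where "d > 0" and "\<forall>k\<in>I. close k d"
      using uniform_delta_finite[OF \<open>finite I\<close>, of close] by blast
    then have d: "\<bar>feedback p \<sigma> (m k) (n k) u v - feedback p \<sigma> (m k) (n k) u' v'\<bar> \<le> e'"
      if "k \<in> I" "u \<in> {0..R}" "v \<in> {0..R}" "u' \<in> {0..R}" "v' \<in> {0..R}" "\<bar>u - u'\<bar> \<le> d" "\<bar>v - v'\<bar> \<le> d" for k u v u' v'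
      using that unfolding close_def by blast
    have "\<bar>\<Phi> x t - \<Phi> y t\<bar> \<le> e" if x: "x \<in> periodic_box T R" and y: "y \<in> periodic_box T R"
      and xy: "\<forall>t. \<bar>x t - y t\<bar> \<le> d" for x y t
    proof -
      have H_close: "\<bar>H x t - H y t\<bar> \<le> e * b t" for t
      proof -
        have "\<bar>H x t - H y t\<bar> = \<bar>\<Sum>k\<in>I. lam k * r k t *
            (feedback p \<sigma> (m k) (n k) (x (t - \<tau> k t)) (x (t - \<mu> k t))
             - feedback p \<sigma> (m k) (n k) (y (t - \<tau> k t)) (y (t - \<mu> k t)))\<bar>"
          by (simp add: H_def right_diff_distrib sum_subtractf)
        also have "\<dots> \<le> (\<Sum>k\<in>I. lam k * r k (vr k) * e')"
        proof (intro order_trans[OF sum_abs] sum_mono)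
          fix k assume "k \<in> I"
          have "\<bar>feedback p \<sigma> (m k) (n k) (x (t - \<tau> k t)) (x (t - \<mu> k t))
             - feedback p \<sigma> (m k) (n k) (y (t - \<tau> k t)) (y (t - \<mu> k t))\<bar> \<le> e'"
            using x y xy \<open>k \<in> I\<close> by (intro d) (auto simp: periodic_box_def)
          moreover have "lam k * r k t \<le> lam k * r k (vr k)" using vr pos \<open>k \<in> I\<close> by simp
          ultimately show "\<bar>lam k * r k t * (feedback p \<sigma> (m k) (n k) (x (t - \<tau> k t)) (x (t - \<mu> k t))
             - feedback p \<sigma> (m k) (n k) (y (t - \<tau> k t)) (y (t - \<mu> k t)))\<bar> \<le> lam k * r k (vr k) * e'"
            using r_nonneg[OF \<open>k \<in> I\<close>] by (subst abs_mult) (rule mult_mono, auto)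
        qed
        also have "\<dots> = S * e'" by (simp add: S_def sum_distrib_right)
        also have "\<dots> \<le> e * b ub" by (rule Se')
        also have "\<dots> \<le> e * b t" using ub \<open>e > 0\<close> by simp
        finally show ?thesis .
      qed
      have "\<Phi> x t + (- e) \<le> \<Phi> y t"
        by (rule periodic_solution_ge[OF \<Phi>_per[OF y] \<Phi>_deriv[OF y] \<Phi>_per[OF x] \<Phi>_deriv[OF x]])
          (use H_close in \<open>smt (verit) mult_minus_left\<close>)
      moreover have "\<Phi> y t + (- e) \<le> \<Phi> x t"
        by (rule periodic_solution_ge[OF \<Phi>_per[OF x] \<Phi>_deriv[OF x] \<Phi>_per[OF y] \<Phi>_deriv[OF y]])
          (use H_close in \<open>smt (verit) mult_minus_left\<close>)
      ultimately show ?thesis by linarith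
    qed
    then show "\<exists>d>0. \<forall>x\<in>periodic_box T R. \<forall>y\<in>periodic_box T R.
                  (\<forall>t. \<bar>x t - y t\<bar> \<le> d) \<longrightarrow> (\<forall>t. \<bar>\<Phi> x t - \<Phi> y t\<bar> \<le> e)"
      using \<open>d > 0\<close> by blast
  qed
  have x_per: "periodic_fun_simple x T" and x_deriv: "(x has_real_derivative H x t - b t * x t) (at t)" for t
    using \<Phi>_per[OF x] \<Phi>_deriv[OF x] by (simp_all add: fixed)
  have Harnack: "\<sigma> * x s \<le> x t" for s t
    unfolding \<sigma>_def by (rule periodic_solution_Harnack[OF x_per x_deriv H_nonneg])
  have x_ge: "x t \<ge> p" for t
  proof (rule ccontr)
    assume "\<not> x t \<ge> p"
    then have small: "\<sigma> * x s \<le> p" for s using Harnack[of s t] by linarith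
    have "p * b s \<le> H x s" for s
    proof -
      have "p * b s \<le> (\<Sum>k\<in>I. lam k * r k s * (p powr m k / (1 + (p / \<sigma>) powr n k)))"
        using p[of s] by (simp add: \<sigma>_def exp_minus divide_inverse)
      also have "\<dots> \<le> H x s"
        unfolding H_def using \<open>p > 0\<close> \<sigma> pos small
        by (intro sum_mono mult_left_mono feedback_lower r_nonneg) (auto intro: less_imp_le)
      finally show ?thesis .
    qed
    \<comment> \<open>Comparison with the constant \<open>p\<close>, the solution for the forcing
      \<open>p * b t\<close>.\<close>
    then have "0 + p \<le> x t"
      by (intro periodic_solution_ge[OF x_per x_deriv constant_solution]) simp
    then show False using \<open>\<not> x t \<ge> p\<close> by simp
  qed
  have H_eq: "H x t = (\<Sum>k\<in>I. lam k * r k t * (x (t - \<tau> k t) powr m k / (1 + x (t - \<mu> k t) powr n k)))" for t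
    by (simp add: H_def feedback_eq x_ge Harnack)
  show ?thesis
  proof (intro exI[of _ x] conjI allI)
    show "x t > 0" for t using x_ge[of t] \<open>p > 0\<close> by simp
  qed (use x_per x_deriv in \<open>simp_all add: H_eq\<close>)
qed

subsection \<open>The lower level\<close>

text \<open>Divide the inequality by \<open>p\<close> and let \<open>p\<close> tend to 0; the
  weights \<open>1 / (1 + (p * exp C) powr n k)\<close> tend to 1. If some \<open>m i < 1\<close>,
  the single term with \<open>p powr (m i - 1)\<close> blows up. If all exponents are 1, the limit
  is the sum of \<open>lam k * r k t\<close>, which exceeds \<open>b t\<close>.\<close>

lemma lower_solution_exists:
  fixes T C :: real and I :: "'a set" and lam m n :: "'a \<Rightarrow> real"
    and r :: "'a \<Rightarrow> real \<Rightarrow> real" and b :: "real \<Rightarrow> real"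
  assumes "T > 0" and I: "finite I" "I \<noteq> {}"
    and pos: "\<And>k. k \<in> I \<Longrightarrow> lam k > 0 \<and> n k > 0 \<and> m k \<le> 1"
    and r: "\<And>k. k \<in> I \<Longrightarrow> coefficient_function T (r k)"
    and b: "coefficient_function T b"
    and dominate: "(\<exists>i\<in>I. m i < 1) \<or> (\<forall>t. (\<Sum>k\<in>I. lam k * r k t) > b t)"
  shows "\<exists>p>0. \<forall>t. p * b t \<le> (\<Sum>k\<in>I. lam k * r k t * (p powr m k / (1 + (p * exp C) powr n k)))"
proof -
  have b_cont: "continuous_on UNIV b" and b_pos: "b t > 0" and b_per: "periodic_fun_simple b T" for t
    using b by (auto simp: coefficient_function_def)
  have r_pos: "r k t > 0" if "k \<in> I" for k t using r[OF that] by (simp add: coefficient_function_def)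
  have weight: "((\<lambda>p. 1 / (1 + (p * exp C) powr n k)) \<longlongrightarrow> 1) (at_right 0)" if "k \<in> I" for k
  proof -
    have "((\<lambda>p. (p * exp C) powr n k) \<longlongrightarrow> 0) (at_right 0)"
      using pos[OF that] by real_asymp
    then have "((\<lambda>p. 1 / (1 + (p * exp C) powr n k)) \<longlongrightarrow> 1 / (1 + 0)) (at_right 0)"
      by (intro tendsto_intros) auto
    then show ?thesis by simp
  qed
  have gt0: "\<forall>\<^sub>F p in at_right (0::real). p > 0"
    by (rule eventually_at_right_less)
  show ?thesis
  proof (cases "\<exists>i\<in>I. m i < 1")
    case True
    then obtain i where i: "i \<in> I" "m i < 1" by blast
    obtain ub vb where "\<And>t. b ub \<le> b t" and vb: "\<And>t. b t \<le> b vb"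
      using periodic_attains_bounds[OF \<open>T > 0\<close> b_cont b_per] by blast
    have "continuous_on UNIV (r i)" "periodic_fun_simple (r i) T"
      using r[OF i(1)] by (simp_all add: coefficient_function_def)
    then obtain ur vr where ur: "\<And>t. r i ur \<le> r i t" and "\<And>t. r i t \<le> r i vr"
      using periodic_attains_bounds[OF \<open>T > 0\<close>] by blast
    have c: "lam i * r i ur > 0" using pos[OF i(1)] r_pos[OF i(1)] by simp
    have "filterlim (\<lambda>p::real. p powr (m i - 1)) at_top (at_right 0)"
      using i(2) by real_asymp
    then have "filterlim (\<lambda>p. lam i * r i ur * (1 / (1 + (p * exp C) powr n i)) * p powr (m i - 1)) at_top (at_right 0)"
      using c by (intro filterlim_tendsto_pos_mult_at_top[OF tendsto_mult[OF tendsto_const weight[OF i(1)]]]) simp_all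
    then have "\<forall>\<^sub>F p in at_right 0. lam i * r i ur * (1 / (1 + (p * exp C) powr n i)) * p powr (m i - 1) \<ge> b vb \<and> p > 0"
      using gt0 by (intro eventually_conj) (auto simp: filterlim_at_top)
    then obtain p where p: "p > 0" "lam i * r i ur * (1 / (1 + (p * exp C) powr n i)) * p powr (m i - 1) \<ge> b vb"
      using eventually_happens trivial_limit_at_right_real by blast
    have "p * b t \<le> (\<Sum>k\<in>I. lam k * r k t * (p powr m k / (1 + (p * exp C) powr n k)))" for t
    proof -
      have "p * b t \<le> p * b vb" using vb p by simp
      also have "\<dots> \<le> p * (lam i * r i ur * (1 / (1 + (p * exp C) powr n i)) * p powr (m i - 1))"
        using p by (intro mult_left_mono) simp_all
      also have "\<dots> = lam i * r i ur * (p powr m i / (1 + (p * exp C) powr n i))"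
        using \<open>p > 0\<close> by (simp add: powr_diff)
      also have "\<dots> \<le> lam i * r i t * (p powr m i / (1 + (p * exp C) powr n i))"
        using ur pos[OF i(1)] by (intro mult_right_mono) (auto simp: add_nonneg_nonneg)
      also have "\<dots> \<le> (\<Sum>k\<in>I. lam k * r k t * (p powr m k / (1 + (p * exp C) powr n k)))"
        using i(1) I pos r_pos
        by (intro member_le_sum) (auto intro!: mult_nonneg_nonneg divide_nonneg_nonneg add_nonneg_nonneg intro: less_imp_le)
      finally show ?thesis .
    qed
    then show ?thesis using p by blast
  next
    case False
    then have m1: "m k = 1" if "k \<in> I" for k using pos[OF that] that by (meson antisym not_less)
    have dom: "(\<Sum>k\<in>I. lam k * r k t) > b t" for t using dominate False by blast
    \<comment> \<open>The periodic ratio \<open>g\<close> attains its minimum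
      \<open>g u > 1\<close>. This turns the pointwise strict inequality into a gap uniform in
      \<open>t\<close>, which absorbs weights above \<open>1 / g u\<close>.\<close>
    define g where "g t = (\<Sum>k\<in>I. lam k * r k t) / b t" for t
    have "continuous_on UNIV g"
      unfolding g_def using r b_cont b_pos by (intro continuous_intros) (auto simp: coefficient_function_def less_imp_neq[symmetric])
    moreover have "periodic_fun_simple g T"
    proof
      fix t
      show "g (t + T) = g t"
        unfolding g_def using r b by (simp add: coefficient_function_shift cong: sum.cong)
    qed
    ultimately obtain u v where u: "\<And>t. g u \<le> g t" and "\<And>t. g t \<le> g v"
      using periodic_attains_bounds[OF \<open>T > 0\<close>, of g] by blast
    have "g u > 1" using dom[of u] b_pos[of u] by (simp add: g_def)
    then have "1 / g u < 1" by simp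
    then have "\<forall>k\<in>I. \<forall>\<^sub>F p in at_right 0. 1 / g u < 1 / (1 + (p * exp C) powr n k)"
      using weight order_tendstoD(1) by fast
    then have "\<forall>\<^sub>F p in at_right 0. (\<forall>k\<in>I. 1 / g u < 1 / (1 + (p * exp C) powr n k)) \<and> p > 0"
      using I gt0 by (intro eventually_conj) (simp_all add: eventually_ball_finite)
    then obtain p where p: "p > 0" "\<forall>k\<in>I. 1 / g u < 1 / (1 + (p * exp C) powr n k)"
      using eventually_happens trivial_limit_at_right_real by blast
    have "p * b t \<le> (\<Sum>k\<in>I. lam k * r k t * (p powr m k / (1 + (p * exp C) powr n k)))" for t
    proof -
      have "b t * g u \<le> b t * g t" using u b_pos[of t] by simp
      then have "b t * g u \<le> (\<Sum>k\<in>I. lam k * r k t)" using b_pos[of t] by (simp add: g_def)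
      then have "b t \<le> (\<Sum>k\<in>I. lam k * r k t) * (1 / g u)" using \<open>g u > 1\<close> by (simp add: field_simps)
      then have "p * b t \<le> p * ((\<Sum>k\<in>I. lam k * r k t) * (1 / g u))"
        using p by (intro mult_left_mono) simp_all
      also have "\<dots> = (\<Sum>k\<in>I. lam k * r k t * (p * (1 / g u)))" by (simp add: sum_distrib_left sum_distrib_right mult_ac)
      also have "\<dots> \<le> (\<Sum>k\<in>I. lam k * r k t * (p powr m k / (1 + (p * exp C) powr n k)))"
      proof (rule sum_mono)
        fix k assume "k \<in> I"
        have "p * (1 / g u) \<le> p * (1 / (1 + (p * exp C) powr n k))"
          using p \<open>k \<in> I\<close> by (intro mult_left_mono) auto
        then have "p * (1 / g u) \<le> p powr m k / (1 + (p * exp C) powr n k)"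
          using m1[OF \<open>k \<in> I\<close>] p by simp
        then show "lam k * r k t * (p * (1 / g u)) \<le> lam k * r k t * (p powr m k / (1 + (p * exp C) powr n k))"
          using pos[OF \<open>k \<in> I\<close>] r_pos[OF \<open>k \<in> I\<close>, of t] by (intro mult_left_mono) auto
      qed
      finally show ?thesis .
    qed
    then show ?thesis using p by blast
  qed
qed

section \<open>A lower level under each of the three conditions\<close>

theorem theorem2p2:
  fixes T C :: real and M :: nat
    and lam m n :: "nat \<Rightarrow> real"
    and r \<tau> \<mu> :: "nat \<Rightarrow> real \<Rightarrow> real"
    and b :: "real \<Rightarrow> real"
  assumes "T > 0" and "M \<ge> 1"
    and "\<forall>k\<in>{1..M}. lam k > 0 \<and> m k > 0 \<and> n k > 0"
    and "\<forall>k\<in>{1..M}. coefficient_function T (r k) \<and> coefficient_function T (\<tau> k) \<and>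
           coefficient_function T (\<mu> k)"
    and "coefficient_function T b"
    and "C = integral {0..T} b"
    and "\<forall>k\<in>{1..M}. m k < n k + 1"
    and "(\<exists>i\<in>{1..M}. m i < 1)
       \<or> ((\<forall>k\<in>{1..M}. m k \<ge> 1) \<and> (\<exists>i\<in>{1..M}. m i = 1) \<and>
          (\<forall>t. (\<Sum>k | k \<in> {1..M} \<and> m k = 1. lam k * r k t) > b t))
       \<or> ((\<forall>k\<in>{1..M}. m k > 1) \<and>
          (\<exists>\<gamma>\<^sub>1. \<forall>t. (\<Sum>k=1..M. lam k * r k t *
             (exp ((m k - 1) * \<gamma>\<^sub>1) / (1 + exp (n k * (\<gamma>\<^sub>1 + C))))) > b t))"
  shows "\<exists>x. positive_periodic_solution T M lam m n r \<tau> \<mu> b x"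
proof -
  have term_nonneg: "0 \<le> lam k * r k t * (p powr m k / (1 + (p * exp C) powr n k))" if "k \<in> {1..M}" for k t p
    using that assms(3,4) by (auto simp: coefficient_function_def add_nonneg_nonneg intro!: mult_nonneg_nonneg divide_nonneg_nonneg intro: less_imp_le)
  \<comment> \<open>Omitted terms are nonnegative, so a lower level for a subfamily serves the whole
    sum. The first condition uses \<open>{i}\<close>, since other exponents may exceed 1; the second
    uses the indices with \<open>m k = 1\<close>.\<close>
  have restrict: "\<exists>p>0. \<forall>t. p * b t \<le> (\<Sum>k=1..M. lam k * r k t * (p powr m k / (1 + (p * exp C) powr n k)))"
    if I: "I \<subseteq> {1..M}" "I \<noteq> {}" "\<And>k. k \<in> I \<Longrightarrow> m k \<le> 1"
      and dom: "(\<exists>i\<in>I. m i < 1) \<or> (\<forall>t. (\<Sum>k\<in>I. lam k * r k t) > b t)" for I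
  proof -
    have "finite I" using I(1) finite_subset by blast
    have "\<exists>p>0. \<forall>t. p * b t \<le> (\<Sum>k\<in>I. lam k * r k t * (p powr m k / (1 + (p * exp C) powr n k)))"
      by (rule lower_solution_exists[OF \<open>T > 0\<close> \<open>finite I\<close> I(2) _ _ assms(5) dom])
        (use assms(3,4) I in auto)
    moreover have "(\<Sum>k\<in>I. lam k * r k t * (p powr m k / (1 + (p * exp C) powr n k)))
        \<le> (\<Sum>k=1..M. lam k * r k t * (p powr m k / (1 + (p * exp C) powr n k)))" for p t
      using term_nonneg I(1) by (intro sum_mono2) auto
    ultimately show ?thesis by (meson order_trans)
  qed
  have "\<exists>p>0. \<forall>t. p * b t \<le> (\<Sum>k=1..M. lam k * r k t * (p powr m k / (1 + (p * exp C) powr n k)))"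
    using assms(8)
  proof (elim disjE conjE)
    assume "\<exists>i\<in>{1..M}. m i < 1"
    then obtain i where "i \<in> {1..M}" "m i < 1" by blast
    then show ?thesis by (intro restrict[of "{i}"]) auto
  next
    assume "\<exists>i\<in>{1..M}. m i = 1" "\<forall>t. (\<Sum>k | k \<in> {1..M} \<and> m k = 1. lam k * r k t) > b t"
    then show ?thesis by (intro restrict[of "{k \<in> {1..M}. m k = 1}"]) auto
  next
    assume "\<exists>\<gamma>. \<forall>t. (\<Sum>k=1..M. lam k * r k t * (exp ((m k - 1) * \<gamma>) / (1 + exp (n k * (\<gamma> + C))))) > b t"
    then obtain \<gamma> where \<gamma>: "\<And>t. (\<Sum>k=1..M. lam k * r k t * (exp ((m k - 1) * \<gamma>) / (1 + exp (n k * (\<gamma> + C))))) > b t" by blast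
    \<comment> \<open>The third condition, multiplied by \<open>exp \<gamma>\<close>, is exactly the
      inequality for the level \<open>p = exp \<gamma>\<close>, in strict form.\<close>
    have "exp \<gamma> * b t \<le> (\<Sum>k=1..M. lam k * r k t * (exp \<gamma> powr m k / (1 + (exp \<gamma> * exp C) powr n k)))" for t
    proof -
      have "exp \<gamma> * b t \<le> exp \<gamma> * (\<Sum>k=1..M. lam k * r k t * (exp ((m k - 1) * \<gamma>) / (1 + exp (n k * (\<gamma> + C)))))"
        using \<gamma>[of t] by simp
      also have "\<dots> = (\<Sum>k=1..M. lam k * r k t * (exp (\<gamma> + (m k - 1) * \<gamma>) / (1 + exp (n k * (\<gamma> + C)))))"
        by (simp add: sum_distrib_left exp_add mult_ac)
      also have "\<dots> = (\<Sum>k=1..M. lam k * r k t * (exp \<gamma> powr m k / (1 + (exp \<gamma> * exp C) powr n k)))"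
        by (simp add: powr_def left_diff_distrib flip: exp_add)
      finally show ?thesis .
    qed
    then show ?thesis by (intro exI[of _ "exp \<gamma>"]) auto
  qed
  then obtain p where "p > 0" and
    p: "\<And>t. p * b t \<le> (\<Sum>k=1..M. lam k * r k t * (p powr m k / (1 + (p * exp C) powr n k)))" by blast
  show ?thesis
    unfolding positive_periodic_solution_def
    by (rule delay_equation_positive_periodic_solution[OF \<open>T > 0\<close> _ _ _ _ _ assms(5,6) \<open>p > 0\<close> p])
      (use assms(3,4,7) in auto)
qed

end
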